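(* Let $n\ge 1$. For $1\le i,j\le n$, let $q_n^{\mathrm{i}}(i,j)$ denote the number of weakly-increasing parking functions of $1,\ldots,n$ in which the $i$-th car prefers the $j$-th spot and the $i$-th car is lucky. Then \[ q_n^{\mathrm{i}}(i,j)=\begin{cases} C_{i-1}C_{n-i+1}&\text{if }i=j,\\ 0&\text{otherwise.}\end{cases} \] In particular, for each $1\le i\le n$, the number of weakly-increasing parking functions of $1,\ldots,n$ for which the $i$-th car is lucky is $C_{i-1}C_{n-i+1}$, and likewise the number for which the $i$-th spot is lucky is $C_{i-1}C_{n-i+1}$.
   Context: There are $n$ spots labeled $1,\ldots,n$ in order along a one-way street, and $n$ cars entering one after another, car $i$ having preference $a_i\in\{1,\ldots,n\}$. Each car drives to its preferred spot and parks there if it is available; otherwise it moves forward and parks in the first available later spot, if any (if none, it fails to park). A parking function of $1,\ldots,n$ is a sequence of preferences $(a_1,\ldots,a_n)$ such that all $n$ cars are able to park; it is weakly-increasing if $a_1\le a_2\le\cdots\le a_n$. A car is lucky if it parks in its preferred spot; a spot is lucky if the car that parks in it prefers that spot. $C_m=\frac1{m+1}\binom{2m}{m}$ is the $m$-th Catalan number. *)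

theory Defs
  imports Complex_Main
begin

text \<open>Preference sequences are lists; the preference of car \<open>i\<close> (\<open>i = 1, \<dots>, n\<close>)
  is the list entry at position \<open>i - 1\<close>. Spots are the numbers \<open>1, \<dots>, n\<close>.\<close>

definition parking_spot :: "nat \<Rightarrow> nat set \<Rightarrow> nat \<Rightarrow> nat option" where
  "parking_spot n occupied a = find (\<lambda>s. s \<notin> occupied) [a..<Suc n]"

text \<open>Entry \<open>i - 1\<close> of the result is the spot in which car \<open>i\<close> parks,
  or \<open>None\<close> if car \<open>i\<close> fails to park.\<close>

fun park :: "nat \<Rightarrow> nat set \<Rightarrow> nat list \<Rightarrow> nat option list" where
  "park n occupied [] = []"
| "park n occupied (a # as) =
     (case parking_spot n occupied a of
        None \<Rightarrow> None # park n occupied as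
      | Some s \<Rightarrow> Some s # park n (insert s occupied) as)"

definition pref :: "nat list \<Rightarrow> nat \<Rightarrow> nat" where
  "pref as i = as ! (i - 1)"

definition outcome :: "nat \<Rightarrow> nat list \<Rightarrow> nat \<Rightarrow> nat option" where
  "outcome n as i = park n {} as ! (i - 1)"

definition parking_function :: "nat \<Rightarrow> nat list \<Rightarrow> bool" where
  "parking_function n as \<longleftrightarrow>
     length as = n \<and> set as \<subseteq> {1..n} \<and> (\<forall>i\<in>{1..n}. outcome n as i \<noteq> None)"

definition weakly_increasing_pf :: "nat \<Rightarrow> nat list set" where
  "weakly_increasing_pf n = {as. parking_function n as \<and> sorted as}"

definition lucky_car :: "nat \<Rightarrow> nat list \<Rightarrow> nat \<Rightarrow> bool" where
  "lucky_car n as i \<longleftrightarrow> outcome n as i = Some (pref as i)"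

definition lucky_spot :: "nat \<Rightarrow> nat list \<Rightarrow> nat \<Rightarrow> bool" where
  "lucky_spot n as j \<longleftrightarrow> (\<exists>i\<in>{1..n}. outcome n as i = Some j \<and> pref as i = j)"

definition q_inc :: "nat \<Rightarrow> nat \<Rightarrow> nat \<Rightarrow> nat" where
  "q_inc n i j = card {as \<in> weakly_increasing_pf n. pref as i = j \<and> lucky_car n as i}"

definition catalan :: "nat \<Rightarrow> real" where
  "catalan m = 1 / (real m + 1) * real ((2 * m) choose m)"

end

theory Submission
  imports Defs
begin

text \<open>In a weakly increasing parking function car \<open>i\<close> always parks in spot \<open>i\<close>, so these functions
  are exactly the sorted sequences with \<open>1 \<le> a\<^sub>i \<le> i\<close>, and car \<open>i\<close> (equivalently spot \<open>i\<close>) is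
  lucky iff \<open>a\<^sub>i = i\<close>. Such a sequence splits at position \<open>i\<close> into two arbitrary sequences of the
  same kind, the second one shifted by \<open>i - 1\<close>. The sequences themselves are counted by the ballot
  numbers: those of length \<open>n\<close> with entries at most \<open>m \<le> n + 1\<close> number
  \<open>binomial (n + m - 1) n - binomial (n + m - 1) (n + 1)\<close>.\<close>

definition dominated_lists :: "nat \<Rightarrow> nat list set" where
  "dominated_lists n = {as. length as = n \<and> sorted as \<and> (\<forall>k<n. 1 \<le> as ! k \<and> as ! k \<le> Suc k)}"

text \<open>The cap \<open>m\<close> on the entries is the second parameter needed for a recursion;
  once \<open>m\<close> reaches \<open>n\<close> it no longer restricts anything.\<close>

definition ballot_lists :: "nat \<Rightarrow> nat \<Rightarrow> nat list set" where
  "ballot_lists n m = {as \<in> dominated_lists n. set as \<subseteq> {..m}}"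

section \<open>Outcomes of weakly increasing preferences\<close>

lemma length_park [simp]: "length (park n occ as) = length as"
  by (induction as arbitrary: occ) (auto split: option.split)

lemma parking_spot_SomeD:
  assumes "parking_spot n occ a = Some s"
  shows "a \<le> s" "s \<le> n" "s \<notin> occ"
  using assms by (auto simp: parking_spot_def find_Some_iff simp del: upt_Suc)

lemma parking_spot_initial:
  assumes "1 \<le> a" "a \<le> Suc j" "Suc j \<le> n"
  shows "parking_spot n {1..j} a = Some (Suc j)"
  unfolding parking_spot_def find_Some_iff
  \<comment> \<open>The witness is the index of \<open>Suc j\<close> in \<open>[a..<Suc n]\<close>;
    every earlier element of that list lies in \<open>{1..j}\<close>.\<close>
  using assms by (intro exI[of _ "Suc j - a"]) (auto simp del: upt_Suc)

text \<open>Each car finds exactly an initial segment occupied and extends it by one spot. The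
  offset \<open>j\<close> lets the induction start from any such segment.\<close>

lemma park_initial:
  assumes "\<forall>k<length as. 1 \<le> as ! k \<and> as ! k \<le> Suc (j + k)" "j + length as \<le> n"
  shows "park n {1..j} as = map Some [Suc j..<Suc (j + length as)]"
  using assms
proof (induction as arbitrary: j)
  case (Cons a as)
  have "parking_spot n {1..j} a = Some (Suc j)"
    using Cons.prems by (intro parking_spot_initial) auto
  moreover have "insert (Suc j) {1..j} = {1..Suc j}"
    by auto
  moreover have "park n {1..Suc j} as = map Some [Suc (Suc j)..<Suc (Suc j + length as)]"
  proof (rule Cons.IH)
    show "\<forall>k<length as. 1 \<le> as ! k \<and> as ! k \<le> Suc (Suc j + k)"
      using Cons.prems(1) by (metis Suc_less_eq add_Suc_shift length_Cons nth_Cons_Suc)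
  qed (use Cons.prems in auto)
  ultimately show ?case
    by (simp add: upt_conv_Cons del: upt_Suc)
qed simp

text \<open>Pigeonhole: cars never move backwards, so those preferring a spot beyond
  \<open>j\<close> take distinct free spots beyond \<open>j\<close>.\<close>

lemma length_filter_le_free_spots:
  assumes "None \<notin> set (park n occ as)"
  shows "length (filter (\<lambda>a. j < a) as) \<le> card ({j<..n} - occ)"
  using assms
proof (induction as arbitrary: occ)
  case (Cons a as)
  then obtain s where s: "parking_spot n occ a = Some s"
    by (auto split: option.splits)
  have IH: "length (filter (\<lambda>a. j < a) as) \<le> card ({j<..n} - insert s occ)"
    using Cons s by auto
  have eq: "{j<..n} - insert s occ = ({j<..n} - occ) - {s}"
    by auto
  show ?case
  proof (cases "j < a")
    case True
    then have "s \<in> {j<..n} - occ"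
      using parking_spot_SomeD[OF s] by auto
    then have "card ({j<..n} - occ) = Suc (card ({j<..n} - insert s occ))"
      unfolding eq by (intro card.remove) auto
    then show ?thesis
      using IH True by simp
  next
    case False
    have "card ({j<..n} - insert s occ) \<le> card ({j<..n} - occ)"
      by (intro card_mono) auto
    then show ?thesis
      using IH False by simp
  qed
qed simp

lemma outcome_dominated:
  assumes "as \<in> dominated_lists n" "i \<in> {1..n}"
  shows "outcome n as i = Some i"
proof -
  have "park n {} as = map Some [Suc 0..<Suc n]"
    using park_initial[of as 0 n] assms by (simp add: dominated_lists_def del: upt_Suc)
  moreover have "map Some [Suc 0..<Suc n] ! (i - 1) = Some (Suc 0 + (i - 1))"
    using assms(2) by (subst nth_map) (auto simp del: upt_Suc)
  ultimately show ?thesis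
    using assms(2) by (simp add: outcome_def del: upt_Suc)
qed

lemma weakly_increasing_pf_eq: "weakly_increasing_pf n = dominated_lists n"
proof (intro equalityI subsetI)
  fix as assume as: "as \<in> weakly_increasing_pf n"
  then have len: "length as = n" and sorted: "sorted as" and range: "set as \<subseteq> {1..n}"
    and parks: "\<And>i. i \<in> {1..n} \<Longrightarrow> outcome n as i \<noteq> None"
    by (auto simp: weakly_increasing_pf_def parking_function_def)
  have "park n {} as ! k \<noteq> None" if "k < n" for k
    using parks[of "Suc k"] that by (simp add: outcome_def)
  then have parked: "None \<notin> set (park n {} as)"
    using len by (metis in_set_conv_nth length_park)
  \<comment> \<open>If this failed, sortedness would make the last \<open>n - k\<close> cars all
    prefer spots beyond \<open>Suc k\<close>, but only \<open>n - Suc k\<close> such spots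
    exist.\<close>
  have "as ! k \<le> Suc k" if "k < n" for k
  proof (rule ccontr)
    assume "\<not> as ! k \<le> Suc k"
    moreover have "as ! k \<le> a" if a: "a \<in> set (drop k as)" for a
    proof -
      obtain l where "l < n - k" "a = as ! (k + l)"
        using a len \<open>k < n\<close> by (auto simp: in_set_conv_nth)
      then show ?thesis
        using sorted len by (simp add: sorted_nth_mono)
    qed
    ultimately have "filter (\<lambda>a. Suc k < a) (drop k as) = drop k as"
      by (force simp: filter_id_conv)
    then have "n - k \<le> length (filter (\<lambda>a. Suc k < a) (take k as @ drop k as))"
      using len unfolding filter_append by simp
    also have "\<dots> \<le> card ({Suc k<..n} - {})"
      unfolding append_take_drop_id by (rule length_filter_le_free_spots[OF parked])
    finally show False
      using \<open>k < n\<close> by simp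
  qed
  then show "as \<in> dominated_lists n"
    using len sorted range by (auto simp: dominated_lists_def subset_iff in_set_conv_nth)
next
  fix as assume as: "as \<in> dominated_lists n"
  then have "set as \<subseteq> {1..n}"
    by (fastforce simp: dominated_lists_def in_set_conv_nth)
  then show "as \<in> weakly_increasing_pf n"
    using as outcome_dominated[OF as]
    by (auto simp: weakly_increasing_pf_def parking_function_def dominated_lists_def)
qed

lemma lucky_car_dominated:
  assumes "as \<in> dominated_lists n" "i \<in> {1..n}"
  shows "lucky_car n as i \<longleftrightarrow> pref as i = i"
  using outcome_dominated[OF assms] by (auto simp: lucky_car_def)

text \<open>Since car \<open>i\<close> parks in spot \<open>i\<close> for every \<open>i\<close>,
  the only possible witness for the existential in \<open>lucky_spot\<close> is car \<open>i\<close>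
  itself.\<close>

lemma lucky_spot_dominated:
  assumes "as \<in> dominated_lists n" "i \<in> {1..n}"
  shows "lucky_spot n as i \<longleftrightarrow> pref as i = i"
  using outcome_dominated[OF assms(1)] assms(2) by (auto simp: lucky_spot_def)

section \<open>Counting\<close>

lemma finite_ballot_lists: "finite (ballot_lists n m)"
proof (rule finite_subset)
  show "ballot_lists n m \<subseteq> {as. set as \<subseteq> {..m} \<and> length as = n}"
    by (auto simp: ballot_lists_def dominated_lists_def)
qed (simp add: finite_lists_length_eq)

lemma dominated_lists_eq_ballot_lists:
  assumes "n \<le> m"
  shows "ballot_lists n m = dominated_lists n"
  using assms by (fastforce simp: ballot_lists_def dominated_lists_def in_set_conv_nth)

lemma ballot_lists_0: "ballot_lists 0 m = {[]}"
  by (auto simp: ballot_lists_def dominated_lists_def)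

lemma ballot_lists_Suc_0: "ballot_lists (Suc n) 0 = {}"
proof -
  have "as \<notin> ballot_lists (Suc n) 0" for as
  proof
    assume as: "as \<in> ballot_lists (Suc n) 0"
    then have "as ! 0 \<in> set as" "1 \<le> as ! 0"
      by (auto simp: ballot_lists_def dominated_lists_def)
    then show False
      using as by (auto simp: ballot_lists_def)
  qed
  then show ?thesis
    by blast
qed

lemma snoc_mem_dominated_lists_iff:
  "as @ [x] \<in> dominated_lists (Suc n) \<longleftrightarrow>
     as \<in> dominated_lists n \<and> (\<forall>a\<in>set as. a \<le> x) \<and> 1 \<le> x \<and> x \<le> Suc n"
  by (auto simp: dominated_lists_def sorted_append nth_append less_Suc_eq)

text \<open>The last entry is the maximum, so the split is by whether it equals
  \<open>Suc m\<close>. The hypothesis \<open>m \<le> n\<close> makes \<open>Suc m\<close> an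
  admissible last entry.\<close>

lemma ballot_lists_Suc_Suc:
  assumes "m \<le> n"
  shows "ballot_lists (Suc n) (Suc m) =
           ballot_lists (Suc n) m \<union> (\<lambda>as. as @ [Suc m]) ` ballot_lists n (Suc m)"
proof (intro equalityI subsetI)
  fix as assume as: "as \<in> ballot_lists (Suc n) (Suc m)"
  then have "length as = Suc n"
    by (simp add: ballot_lists_def dominated_lists_def)
  then obtain bs x where bs: "as = bs @ [x]"
    by (metis length_Suc_conv_rev)
  show "as \<in> ballot_lists (Suc n) m \<union> (\<lambda>as. as @ [Suc m]) ` ballot_lists n (Suc m)"
  proof (cases "x = Suc m")
    case True
    then show ?thesis
      using as by (auto simp: bs ballot_lists_def snoc_mem_dominated_lists_iff)
  next
    case False
    then show ?thesis
      using as by (force simp: bs ballot_lists_def snoc_mem_dominated_lists_iff)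
  qed
next
  fix as
  assume "as \<in> ballot_lists (Suc n) m \<union> (\<lambda>as. as @ [Suc m]) ` ballot_lists n (Suc m)"
  then show "as \<in> ballot_lists (Suc n) (Suc m)"
    using assms by (auto simp: ballot_lists_def snoc_mem_dominated_lists_iff)
qed

lemma card_ballot_lists_Suc_Suc:
  assumes "m \<le> n"
  shows "card (ballot_lists (Suc n) (Suc m)) =
           card (ballot_lists (Suc n) m) + card (ballot_lists n (Suc m))"
proof -
  have "card (ballot_lists (Suc n) (Suc m)) = card (ballot_lists (Suc n) m)
          + card ((\<lambda>as. as @ [Suc m]) ` ballot_lists n (Suc m))"
    unfolding ballot_lists_Suc_Suc[OF assms]
    by (rule card_Un_disjoint) (simp_all add: finite_ballot_lists, auto simp: ballot_lists_def)
  then show ?thesis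
    by (simp add: card_image inj_on_def)
qed

text \<open>The ballot number formula, written additively to avoid truncated subtraction. Both
  binomials obey Pascal's rule, matching the recursion for the cardinalities. The range includes
  \<open>m = Suc n\<close> because the recursion reaches that case.\<close>

lemma card_ballot_lists:
  assumes "m \<le> Suc n"
  shows "card (ballot_lists n m) + ((n + m - 1) choose Suc n) = (n + m - 1) choose n"
  using assms
proof (induction n arbitrary: m)
  case 0
  then show ?case
    by (auto simp: ballot_lists_0 le_Suc_eq)
next
  case (Suc n)
  have *: "card (ballot_lists (Suc n) m) + ((n + m) choose Suc (Suc n)) = (n + m) choose Suc n"
    if "m \<le> Suc n" for m
    using that
  proof (induction m)
    case 0
    then show ?case
      by (simp add: ballot_lists_Suc_0 binomial_eq_0)
  next
    case (Suc m)
    \<comment> \<open>Here \<open>Suc.IH\<close> is the inner hypothesis, for length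
      \<open>Suc n\<close> and cap \<open>m\<close>; the quoted fact is the outer one, used for
      length \<open>n\<close> and cap \<open>Suc m\<close>. Pascal's rule combines them.\<close>
    then show ?case
      using Suc.IH \<open>\<And>m. m \<le> Suc n \<Longrightarrow> _\<close>[of "Suc m"] card_ballot_lists_Suc_Suc[of m n] by simp
  qed
  show ?case
  proof (cases "m = Suc (Suc n)")
    case True
    \<comment> \<open>Beyond the reach of the recursion: raising the cap from \<open>Suc n\<close>
      to \<open>Suc (Suc n)\<close> adds no lists, and the binomials agree because the two middle
      ones in row \<open>Suc (2 * n)\<close> are equal.\<close>
    have "card (ballot_lists (Suc n) m) = card (ballot_lists (Suc n) (Suc n))"
      by (simp add: True dominated_lists_eq_ballot_lists)
    moreover have "Suc (2 * n) choose n = Suc (2 * n) choose Suc n"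
      using binomial_symmetric[of n "Suc (2 * n)"] by simp
    ultimately show ?thesis
      using *[of "Suc n"] by (simp add: True mult_2)
  next
    case False
    then show ?thesis
      using *[of m] Suc.prems by simp
  qed
qed

lemma card_dominated_lists: "real (card (dominated_lists n)) = catalan n"
proof -
  have "card (dominated_lists n) + (2 * n choose Suc n) = 2 * n choose n"
    using card_ballot_lists[of "Suc n" n] by (simp add: dominated_lists_eq_ballot_lists mult_2)
  then have sum: "real (card (dominated_lists n)) + real (2 * n choose Suc n) = real (2 * n choose n)"
    by (metis of_nat_add)
  \<comment> \<open>By the two absorption identities both sides equal
    \<open>2 * n * ((2 * n - 1) choose n)\<close>. This ratio turns the difference of binomials into
    the Catalan number.\<close>
  have "Suc n * (2 * n choose Suc n) = n * (2 * n choose n)"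
    using binomial_absorption[of n "2 * n"] binomial_absorb_comp[of "2 * n" n]
    by (simp del: mult_cancel1 mult_cancel2 add: mult_2)
  then have ratio: "(real n + 1) * real (2 * n choose Suc n) = real n * real (2 * n choose n)"
    by (metis of_nat_Suc of_nat_mult add.commute)
  have "(real n + 1) * real (card (dominated_lists n))
      = (real n + 1) * (real (card (dominated_lists n)) + real (2 * n choose Suc n))
          - (real n + 1) * real (2 * n choose Suc n)"
    by (simp add: algebra_simps)
  also have "\<dots> = real (2 * n choose n)"
    unfolding sum ratio by (simp add: algebra_simps)
  finally show ?thesis
    by (simp add: catalan_def field_simps)
qed

section \<open>Splitting at a fixed entry\<close>

text \<open>The index \<open>i\<close> counts from 0, so the entry \<open>Suc i\<close> is the
  largest allowed there. Entries before it are at most \<open>i\<close> by domination and those from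
  it on are at least \<open>Suc i\<close> by sortedness, so the two blocks do not constrain each
  other.\<close>

lemma bij_betw_split_dominated:
  assumes "i < n"
  shows "bij_betw (\<lambda>(bs, cs). bs @ map (\<lambda>c. c + i) cs)
           (dominated_lists i \<times> dominated_lists (n - i))
           {as \<in> dominated_lists n. as ! i = Suc i}"
proof (rule bij_betw_byWitness[where f' = "\<lambda>as. (take i as, map (\<lambda>a. a - i) (drop i as))"])
  show "\<forall>p\<in>dominated_lists i \<times> dominated_lists (n - i).
          (\<lambda>as. (take i as, map (\<lambda>a. a - i) (drop i as)))
            ((\<lambda>(bs, cs). bs @ map (\<lambda>c. c + i) cs) p) = p"
    by (auto simp: dominated_lists_def comp_def)
  \<comment> \<open>This keeps the shifted entries positive and makes adding \<open>i\<close> undo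
    the truncated subtraction \<open>a - i\<close>.\<close>
  have ge: "Suc i \<le> a"
    if as: "as \<in> dominated_lists n" "as ! i = Suc i" "a \<in> set (drop i as)" for as a
  proof -
    obtain k where k: "k < n - i" "a = as ! (i + k)"
      using as assms by (force simp: dominated_lists_def in_set_conv_nth)
    then show ?thesis
      using as sorted_nth_mono[of as i "i + k"] by (simp add: dominated_lists_def)
  qed
  show "\<forall>as\<in>{as \<in> dominated_lists n. as ! i = Suc i}.
          (\<lambda>(bs, cs). bs @ map (\<lambda>c. c + i) cs) (take i as, map (\<lambda>a. a - i) (drop i as)) = as"
  proof clarsimp
    fix as assume as: "as \<in> dominated_lists n" "as ! i = Suc i"
    have "map ((\<lambda>c. c + i) \<circ> (\<lambda>a. a - i)) (drop i as) = drop i as"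
      by (rule map_idI) (use ge[OF as] in fastforce)
    then show "take i as @ map ((\<lambda>c. c + i) \<circ> (\<lambda>a. a - i)) (drop i as) = as"
      by simp
  qed
  show "(\<lambda>(bs, cs). bs @ map (\<lambda>c. c + i) cs) ` (dominated_lists i \<times> dominated_lists (n - i))
          \<subseteq> {as \<in> dominated_lists n. as ! i = Suc i}"
  proof clarsimp
    fix bs cs assume bs: "bs \<in> dominated_lists i" and cs: "cs \<in> dominated_lists (n - i)"
    have len: "length bs = i" "length cs = n - i"
      using bs cs by (auto simp: dominated_lists_def)
    have nth: "(bs @ map (\<lambda>c. c + i) cs) ! k = (if k < i then bs ! k else cs ! (k - i) + i)"
      if "k < n" for k
      using that len by (simp add: nth_append)
    have le: "b \<le> i" if "b \<in> set bs" for b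
      using that bs by (fastforce simp: dominated_lists_def in_set_conv_nth)
    have "sorted (map (\<lambda>c. c + i) cs)"
      using cs by (simp add: dominated_lists_def sorted_map)
    then have "sorted (bs @ map (\<lambda>c. c + i) cs)"
      using bs le by (auto simp: dominated_lists_def sorted_append intro: trans_le_add2)
    moreover have "1 \<le> (bs @ map (\<lambda>c. c + i) cs) ! k \<and> (bs @ map (\<lambda>c. c + i) cs) ! k \<le> Suc k"
      if "k < n" for k
    proof (cases "k < i")
      case True
      then show ?thesis
        using nth[OF that] bs by (auto simp: dominated_lists_def)
    next
      case False
      then have "k - i < n - i"
        using that by simp
      then have "1 \<le> cs ! (k - i) \<and> cs ! (k - i) \<le> Suc (k - i)"
        using cs by (auto simp: dominated_lists_def)
      then show ?thesis
        using nth[OF that] False by auto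
    qed
    \<comment> \<open>The bounds pin the first entry of the nonempty list \<open>cs\<close>; after
      the shift it becomes the required \<open>Suc i\<close>.\<close>
    moreover have "cs ! 0 = 1"
      using cs assms by (force simp: dominated_lists_def)
    ultimately show "bs @ map (\<lambda>c. c + i) cs \<in> dominated_lists n
        \<and> (bs @ map (\<lambda>c. c + i) cs) ! i = Suc i"
      using len assms nth[of i] by (auto simp: dominated_lists_def)
  qed
  show "(\<lambda>as. (take i as, map (\<lambda>a. a - i) (drop i as))) ` {as \<in> dominated_lists n. as ! i = Suc i}
          \<subseteq> dominated_lists i \<times> dominated_lists (n - i)"
  proof clarsimp
    fix as assume as: "as \<in> dominated_lists n" "as ! i = Suc i"
    have len: "length as = n"
      using as by (simp add: dominated_lists_def)
    have "1 \<le> map (\<lambda>a. a - i) (drop i as) ! k \<and> map (\<lambda>a. a - i) (drop i as) ! k \<le> Suc k"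
      if "k < n - i" for k
    proof -
      have "as ! (i + k) \<in> set (drop i as)"
        using that len by (metis in_set_conv_nth length_drop nth_drop assms less_imp_le)
      then have "Suc i \<le> as ! (i + k)"
        by (rule ge[OF as])
      moreover have "as ! (i + k) \<le> Suc (i + k)"
        using as that by (auto simp: dominated_lists_def)
      ultimately show ?thesis
        using that len by auto
    qed
    moreover have "sorted (map (\<lambda>a. a - i) (drop i as))"
      using as by (auto simp: dominated_lists_def sorted_map
          intro: sorted_wrt_mono_rel[of _ "(\<le>)"] sorted_wrt_drop)
    ultimately show "take i as \<in> dominated_lists i \<and>
        map (\<lambda>a. a - i) (drop i as) \<in> dominated_lists (n - i)"
      using as len assms by (auto simp: dominated_lists_def sorted_wrt_take)
  qed
qed

text \<open>Car \<open>i\<close> sits at index \<open>i - 1\<close> and opens the second block,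
  which therefore has length \<open>n - i + 1\<close>.\<close>

lemma card_dominated_fixed:
  assumes "i \<in> {1..n}"
  shows "real (card {as \<in> dominated_lists n. pref as i = i}) = catalan (i - 1) * catalan (n - i + 1)"
proof -
  have "card (dominated_lists (i - 1) \<times> dominated_lists (n - (i - 1)))
      = card {as \<in> dominated_lists n. pref as i = i}"
    using bij_betw_same_card[OF bij_betw_split_dominated[of "i - 1" n]] assms
    by (auto simp: pref_def Suc_diff_le)
  moreover have "n - (i - 1) = n - i + 1"
    using assms by auto
  ultimately show ?thesis
    by (metis card_cartesian_product card_dominated_lists of_nat_mult)
qed

theorem lemma4p1:
  fixes n :: nat
  assumes "n \<ge> 1"
  shows "(\<forall>i\<in>{1..n}. \<forall>j\<in>{1..n}.
            real (q_inc n i j) = (if i = j then catalan (i - 1) * catalan (n - i + 1) else 0))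
       \<and> (\<forall>i\<in>{1..n}. real (card {as \<in> weakly_increasing_pf n. lucky_car n as i})
            = catalan (i - 1) * catalan (n - i + 1))
       \<and> (\<forall>i\<in>{1..n}. real (card {as \<in> weakly_increasing_pf n. lucky_spot n as i})
            = catalan (i - 1) * catalan (n - i + 1))"
proof (intro conjI ballI)
  fix i j assume i: "i \<in> {1..n}"
  \<comment> \<open>A lucky car \<open>i\<close> has preference \<open>i\<close>, so the set is
    empty off the diagonal.\<close>
  have "{as \<in> weakly_increasing_pf n. pref as i = j \<and> lucky_car n as i}
      = (if i = j then {as \<in> dominated_lists n. pref as i = i} else {})"
    using lucky_car_dominated[OF _ i] by (auto simp: weakly_increasing_pf_eq)
  then show "real (q_inc n i j) = (if i = j then catalan (i - 1) * catalan (n - i + 1) else 0)"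
    using card_dominated_fixed[OF i] by (auto simp: q_inc_def)
next
  fix i assume i: "i \<in> {1..n}"
  have "{as \<in> weakly_increasing_pf n. lucky_car n as i} = {as \<in> dominated_lists n. pref as i = i}"
    using lucky_car_dominated[OF _ i] by (auto simp: weakly_increasing_pf_eq)
  then show "real (card {as \<in> weakly_increasing_pf n. lucky_car n as i})
      = catalan (i - 1) * catalan (n - i + 1)"
    using card_dominated_fixed[OF i] by simp
next
  fix i assume i: "i \<in> {1..n}"
  have "{as \<in> weakly_increasing_pf n. lucky_spot n as i} = {as \<in> dominated_lists n. pref as i = i}"
    using lucky_spot_dominated[OF _ i] by (auto simp: weakly_increasing_pf_eq)
  then show "real (card {as \<in> weakly_increasing_pf n. lucky_spot n as i})
      = catalan (i - 1) * catalan (n - i + 1)"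
    using card_dominated_fixed[OF i] by simp
qed

end
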